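(* Let $(X,d)$ be a complete metric space and $\mathcal S\subset X^2$ a set of finite-distance pairs of points containing all finite-distance pairs which are not connected in $X$ by a metric segment. Then the $\mathcal S$-convex completion $\overline{X}^{\mathcal S}$ is complete and convex.
   Context: Metric spaces are allowed infinite distances: a metric takes values in $[0,\infty]$. A pair $(x,x')$ is a finite-distance pair if $d(x,x')<\infty$. A metric space $(X,d)$ is convex if for every $x\ne y\in X$ with $d(x,y)<\infty$ there is some $z\in X$ distinct from both $x$ and $y$ with $d(x,y)=d(x,z)+d(z,y)$. A metric segment in $X$ is an isometry $f:[a,b]\to X$ from a finite interval with its usual distance; it connects its endpoints $f(a)$ and $f(b)$. Gluing: given a metric space $(Z,d)$ and an equivalence relation $\sim$ on $Z$, put $d_\sim(z,z')=\inf\sum_{s=0}^n d(p_s,q_s)$ over all finite sequences with $p_0=z$, $q_n=z'$ and $q_s\sim p_{s+1}$ for $0\le s\le n-1$; the glued space is the metric space obtained from the semi-metric $d_\sim$ by identifying points at distance zero. The $\mathcal S$-convex completion $\overline{X}^{\mathcal S}$ is obtained by gluing to $X$, for each pair $(x,x')\in\mathcal S$, one metric segment $[0,d(x,x')]$ with endpoints $x$ and $x'$: one takes the disjoint union of $X$ and all the segments (infinite distances between distinct pieces) and glues along the relation generated by identifying the endpoints $0$ and $d(x,x')$ of the segment attached to $(x,x')$ with $x$ and $x'$ respectively. *)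

theory Defs
  imports "HOL-Analysis.Analysis"
begin

text \<open>
  The library's metric spaces only have finite distances, so metric spaces with distances in
  \<open>[0, \<infinity>]\<close> are introduced here, with an explicit carrier set; nothing is assumed about
  \<open>d\<close> outside the carrier.
\<close>

locale ext_metric_space =
  fixes X :: "'a set" and d :: "'a \<Rightarrow> 'a \<Rightarrow> ennreal"
  assumes zero_iff: "x \<in> X \<Longrightarrow> y \<in> X \<Longrightarrow> d x y = 0 \<longleftrightarrow> x = y"
    and commute: "x \<in> X \<Longrightarrow> y \<in> X \<Longrightarrow> d x y = d y x"
    and triangle: "x \<in> X \<Longrightarrow> y \<in> X \<Longrightarrow> z \<in> X \<Longrightarrow> d x z \<le> d x y + d y z"

definition ext_Cauchy :: "'a set \<Rightarrow> ('a \<Rightarrow> 'a \<Rightarrow> ennreal) \<Rightarrow> (nat \<Rightarrow> 'a) \<Rightarrow> bool" where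
  "ext_Cauchy X d \<sigma> \<longleftrightarrow>
     range \<sigma> \<subseteq> X \<and> (\<forall>\<epsilon>>0. \<exists>N. \<forall>m\<ge>N. \<forall>n\<ge>N. d (\<sigma> m) (\<sigma> n) < \<epsilon>)"

locale complete_ext_metric_space = ext_metric_space +
  assumes complete: "ext_Cauchy X d \<sigma> \<Longrightarrow> \<exists>x\<in>X. (\<lambda>n. d (\<sigma> n) x) \<longlonglongrightarrow> 0"

locale convex_ext_metric_space = ext_metric_space +
  assumes convex: "x \<in> X \<Longrightarrow> y \<in> X \<Longrightarrow> x \<noteq> y \<Longrightarrow> d x y < \<infinity> \<Longrightarrow>
    \<exists>z\<in>X. z \<noteq> x \<and> z \<noteq> y \<and> d x y = d x z + d z y"

definition metric_segment ::
  "'a set \<Rightarrow> ('a \<Rightarrow> 'a \<Rightarrow> ennreal) \<Rightarrow> real \<Rightarrow> real \<Rightarrow> (real \<Rightarrow> 'a) \<Rightarrow> bool" where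
  "metric_segment X d a b f \<longleftrightarrow>
     a \<le> b \<and> f ` {a..b} \<subseteq> X \<and> (\<forall>s\<in>{a..b}. \<forall>t\<in>{a..b}. d (f s) (f t) = ennreal \<bar>s - t\<bar>)"

definition segment_connected :: "'a set \<Rightarrow> ('a \<Rightarrow> 'a \<Rightarrow> ennreal) \<Rightarrow> 'a \<Rightarrow> 'a \<Rightarrow> bool" where
  "segment_connected X d x y \<longleftrightarrow> (\<exists>a b f. metric_segment X d a b f \<and> f a = x \<and> f b = y)"


subsection \<open>Gluing\<close>

definition glue_chain ::
  "'a set \<Rightarrow> ('a \<times> 'a) set \<Rightarrow> 'a \<Rightarrow> 'a \<Rightarrow> nat \<Rightarrow> (nat \<Rightarrow> 'a) \<Rightarrow> (nat \<Rightarrow> 'a) \<Rightarrow> bool" where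
  "glue_chain Z r z z' n p q \<longleftrightarrow>
     (\<forall>s\<le>n. p s \<in> Z \<and> q s \<in> Z) \<and> p 0 = z \<and> q n = z' \<and> (\<forall>s<n. (q s, p (Suc s)) \<in> r)"

definition glue_semidist ::
  "'a set \<Rightarrow> ('a \<Rightarrow> 'a \<Rightarrow> ennreal) \<Rightarrow> ('a \<times> 'a) set \<Rightarrow> 'a \<Rightarrow> 'a \<Rightarrow> ennreal" where
  "glue_semidist Z d r z z' = Inf {\<Sum>s\<le>n. d (p s) (q s) | n p q. glue_chain Z r z z' n p q}"

definition glue_rel ::
  "'a set \<Rightarrow> ('a \<Rightarrow> 'a \<Rightarrow> ennreal) \<Rightarrow> ('a \<times> 'a) set \<Rightarrow> ('a \<times> 'a) set" where
  "glue_rel Z d r = {(z, z'). z \<in> Z \<and> z' \<in> Z \<and> glue_semidist Z d r z z' = 0}"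

definition glue_space ::
  "'a set \<Rightarrow> ('a \<Rightarrow> 'a \<Rightarrow> ennreal) \<Rightarrow> ('a \<times> 'a) set \<Rightarrow> 'a set set" where
  "glue_space Z d r = Z // glue_rel Z d r"

text \<open>
  The distance between two classes is computed on arbitrary representatives; the choice does not
  matter by \<open>glue_dist_class\<close> below.
\<close>

definition glue_dist ::
  "'a set \<Rightarrow> ('a \<Rightarrow> 'a \<Rightarrow> ennreal) \<Rightarrow> ('a \<times> 'a) set \<Rightarrow> 'a set \<Rightarrow> 'a set \<Rightarrow> ennreal" where
  "glue_dist Z d r A B = glue_semidist Z d r (SOME a. a \<in> A) (SOME b. b \<in> B)"

definition generated_equiv :: "'a set \<Rightarrow> ('a \<times> 'a) set \<Rightarrow> ('a \<times> 'a) set" where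
  "generated_equiv Z R = \<Inter>{E. equiv Z E \<and> R \<subseteq> E}"


subsection \<open>The convex completion\<close>

text \<open>
  \<open>Seg x x' t\<close> is the point with parameter \<open>t\<close> of the segment attached to \<open>(x, x')\<close>.
\<close>

datatype 'a with_segments = Base 'a | Seg 'a 'a real

definition pieces_space ::
  "'a set \<Rightarrow> ('a \<Rightarrow> 'a \<Rightarrow> ennreal) \<Rightarrow> ('a \<times> 'a) set \<Rightarrow> 'a with_segments set" where
  "pieces_space X d S =
     Base ` X \<union> {Seg x x' t | x x' t. (x, x') \<in> S \<and> t \<in> {0..enn2real (d x x')}}"

fun pieces_dist ::
  "('a \<Rightarrow> 'a \<Rightarrow> ennreal) \<Rightarrow> 'a with_segments \<Rightarrow> 'a with_segments \<Rightarrow> ennreal" where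
  "pieces_dist d (Base x) (Base y) = d x y"
| "pieces_dist d (Seg x x' s) (Seg y y' t) =
     (if x = y \<and> x' = y' then ennreal \<bar>s - t\<bar> else \<infinity>)"
| "pieces_dist d (Base _) (Seg _ _ _) = \<infinity>"
| "pieces_dist d (Seg _ _ _) (Base _) = \<infinity>"

definition endpoint_identifications ::
  "('a \<Rightarrow> 'a \<Rightarrow> ennreal) \<Rightarrow> ('a \<times> 'a) set \<Rightarrow> ('a with_segments \<times> 'a with_segments) set" where
  "endpoint_identifications d S =
     {(Seg x x' 0, Base x) | x x'. (x, x') \<in> S} \<union>
     {(Seg x x' (enn2real (d x x')), Base x') | x x'. (x, x') \<in> S}"

definition endpoint_rel ::
  "'a set \<Rightarrow> ('a \<Rightarrow> 'a \<Rightarrow> ennreal) \<Rightarrow> ('a \<times> 'a) set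
    \<Rightarrow> ('a with_segments \<times> 'a with_segments) set" where
  "endpoint_rel X d S = generated_equiv (pieces_space X d S) (endpoint_identifications d S)"

definition convex_completion ::
  "'a set \<Rightarrow> ('a \<Rightarrow> 'a \<Rightarrow> ennreal) \<Rightarrow> ('a \<times> 'a) set \<Rightarrow> 'a with_segments set set" where
  "convex_completion X d S =
     glue_space (pieces_space X d S) (pieces_dist d) (endpoint_rel X d S)"

definition convex_completion_dist ::
  "'a set \<Rightarrow> ('a \<Rightarrow> 'a \<Rightarrow> ennreal) \<Rightarrow> ('a \<times> 'a) set
    \<Rightarrow> 'a with_segments set \<Rightarrow> 'a with_segments set \<Rightarrow> ennreal" where
  "convex_completion_dist X d S =
     glue_dist (pieces_space X d S) (pieces_dist d) (endpoint_rel X d S)"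


subsection \<open>The constructions are well defined\<close>

lemma glue_semidist_le:
  "glue_chain Z r z z' n p q \<Longrightarrow> glue_semidist Z d r z z' \<le> (\<Sum>s\<le>n. d (p s) (q s))"
  unfolding glue_semidist_def by (rule Inf_lower) blast

lemma glue_semidist_greatest:
  "(\<And>n p q. glue_chain Z r z z' n p q \<Longrightarrow> c \<le> (\<Sum>s\<le>n. d (p s) (q s)))
    \<Longrightarrow> c \<le> glue_semidist Z d r z z'"
  unfolding glue_semidist_def by (rule Inf_greatest) blast

lemma glue_semidist_le_dist:
  assumes "z \<in> Z" "z' \<in> Z"
  shows "glue_semidist Z d r z z' \<le> d z z'"
  using glue_semidist_le[of Z r z z' 0 "\<lambda>_. z" "\<lambda>_. z'" d] assms
  by (simp add: glue_chain_def)

lemma glue_chain_append: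
  assumes "equiv Z r" "glue_chain Z r x y n p q" "glue_chain Z r y z m p' q'"
  defines "P \<equiv> \<lambda>s. if s \<le> n then p s else p' (s - Suc n)"
    and "Q \<equiv> \<lambda>s. if s \<le> n then q s else q' (s - Suc n)"
  shows "glue_chain Z r x z (Suc (n + m)) P Q"
    and "(\<Sum>s\<le>Suc (n + m). d (P s) (Q s)) = (\<Sum>s\<le>n. d (p s) (q s)) + (\<Sum>s\<le>m. d (p' s) (q' s))"
proof -
  have mem: "P s \<in> Z \<and> Q s \<in> Z" if "s \<le> Suc (n + m)" for s
    using assms(2,3) that unfolding glue_chain_def P_def Q_def by auto
  have rel: "(Q s, P (Suc s)) \<in> r" if s: "s < Suc (n + m)" for s
  proof -
    consider "s < n" | "s = n" | "n < s" by linarith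
    then show ?thesis
    proof cases
      case 1
      then show ?thesis using assms(2) unfolding glue_chain_def P_def Q_def by auto
    next
      case 2
      have "y \<in> Z" using assms(2) unfolding glue_chain_def by auto
      then have "(y, y) \<in> r" using assms(1) by (simp add: equiv_def refl_on_def)
      then show ?thesis using 2 assms(2,3) unfolding glue_chain_def P_def Q_def by simp
    next
      case 3
      then obtain k where k: "s = Suc (n + k)" using less_iff_Suc_add by auto
      then have "k < m" using s by simp
      then show ?thesis using k assms(3) unfolding glue_chain_def P_def Q_def by simp
    qed
  qed
  show "glue_chain Z r x z (Suc (n + m)) P Q"
    using mem rel assms(2,3) unfolding glue_chain_def P_def Q_def by auto
  have split: "{..Suc (n + m)} = {..n} \<union> (\<lambda>k. k + Suc n) ` {..m}"
  proof -
    have "s \<in> (\<lambda>k. k + Suc n) ` {..m}" if "s \<le> Suc (n + m)" "\<not> s \<le> n" for s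
      using that by (intro image_eqI[of _ _ "s - Suc n"]) auto
    then show ?thesis by auto
  qed
  have "(\<Sum>s\<le>Suc (n + m). d (P s) (Q s))
      = (\<Sum>s\<le>n. d (P s) (Q s)) + (\<Sum>s\<in>(\<lambda>k. k + Suc n) ` {..m}. d (P s) (Q s))"
    unfolding split by (rule sum.union_disjoint) auto
  also have "(\<Sum>s\<in>(\<lambda>k. k + Suc n) ` {..m}. d (P s) (Q s)) = (\<Sum>s\<le>m. d (p' s) (q' s))"
    by (subst sum.reindex) (auto simp: P_def Q_def inj_on_def)
  also have "(\<Sum>s\<le>n. d (P s) (Q s)) = (\<Sum>s\<le>n. d (p s) (q s))"
    by (rule sum.cong) (auto simp: P_def Q_def)
  finally show "(\<Sum>s\<le>Suc (n + m). d (P s) (Q s))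
      = (\<Sum>s\<le>n. d (p s) (q s)) + (\<Sum>s\<le>m. d (p' s) (q' s))" .
qed

lemma glue_semidist_triangle:
  assumes "equiv Z r"
  shows "glue_semidist Z d r x z \<le> glue_semidist Z d r x y + glue_semidist Z d r y z"
proof -
  have add_Inf: "c \<le> a + Inf B" if "\<And>b. b \<in> B \<Longrightarrow> c \<le> a + b" for a c :: ennreal and B
  proof (cases "a = \<infinity>")
    case False
    have "c - a \<le> b" if "b \<in> B" for b
      using \<open>\<And>b. b \<in> B \<Longrightarrow> c \<le> a + b\<close>[OF that] False
      by (simp add: ennreal_minus_le_iff)
    then have "c - a \<le> Inf B" by (rule Inf_greatest)
    then show ?thesis using ennreal_minus_le_iff[of c a "Inf B"] by blast
  qed simp
  show ?thesis
    unfolding glue_semidist_def[of Z d r y z]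
  proof (rule add_Inf, clarify)
    fix m p' q'
    assume c2: "glue_chain Z r y z m p' q'"
    let ?b = "\<Sum>s\<le>m. d (p' s) (q' s)"
    have "glue_semidist Z d r x z \<le> ?b + glue_semidist Z d r x y"
      unfolding glue_semidist_def[of Z d r x y]
    proof (rule add_Inf, clarify)
      fix n p q
      assume c1: "glue_chain Z r x y n p q"
      show "glue_semidist Z d r x z \<le> ?b + (\<Sum>s\<le>n. d (p s) (q s))"
        using glue_semidist_le[OF glue_chain_append(1)[OF assms c1 c2], of d]
        unfolding glue_chain_append(2)[OF assms c1 c2] by (simp add: add.commute)
    qed
    then show "glue_semidist Z d r x z \<le> glue_semidist Z d r x y + ?b"
      by (simp add: add.commute)
  qed
qed

lemma (in ext_metric_space) glue_semidist_commute_le: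
  assumes "equiv X r"
  shows "glue_semidist X d r y x \<le> glue_semidist X d r x y"
proof (rule glue_semidist_greatest)
  fix n p q
  assume c: "glue_chain X r x y n p q"
  have "(p (n - s), q (n - Suc s)) \<in> r" if "s < n" for s
  proof -
    have "(q (n - Suc s), p (Suc (n - Suc s))) \<in> r"
      using c that unfolding glue_chain_def by simp
    then show ?thesis
      using assms that by (metis Suc_diff_Suc equivE symE)
  qed
  then have "glue_chain X r y x n (\<lambda>s. q (n - s)) (\<lambda>s. p (n - s))"
    using c unfolding glue_chain_def by auto
  then have "glue_semidist X d r y x \<le> (\<Sum>s\<le>n. d (q (n - s)) (p (n - s)))"
    by (rule glue_semidist_le)
  also have "\<dots> = (\<Sum>s\<le>n. d (q s) (p s))"
    by (rule sum.reindex_bij_witness[of _ "\<lambda>s. n - s" "\<lambda>s. n - s"]) auto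
  also have "\<dots> = (\<Sum>s\<le>n. d (p s) (q s))"
    using c unfolding glue_chain_def by (intro sum.cong) (auto intro: commute)
  finally show "glue_semidist X d r y x \<le> (\<Sum>s\<le>n. d (p s) (q s))" .
qed

lemma (in ext_metric_space) glue_semidist_commute:
  "equiv X r \<Longrightarrow> glue_semidist X d r x y = glue_semidist X d r y x"
  by (intro antisym glue_semidist_commute_le)

lemma (in ext_metric_space) glue_semidist_self:
  "x \<in> X \<Longrightarrow> glue_semidist X d r x x = 0"
  using glue_semidist_le_dist[of x X x d r] zero_iff[of x x] by simp

lemma (in ext_metric_space) equiv_glue_rel:
  assumes "equiv X r"
  shows "equiv X (glue_rel X d r)"
proof (rule equivI)
  show "glue_rel X d r \<subseteq> X \<times> X" unfolding glue_rel_def by auto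
  show "refl_on X (glue_rel X d r)"
    unfolding refl_on_def glue_rel_def by (auto simp: glue_semidist_self)
  show "sym (glue_rel X d r)"
    unfolding sym_def glue_rel_def using glue_semidist_commute[OF assms] by auto
  show "trans (glue_rel X d r)"
  proof (rule transI)
    fix x y z
    assume "(x, y) \<in> glue_rel X d r" "(y, z) \<in> glue_rel X d r"
    then show "(x, z) \<in> glue_rel X d r"
      unfolding glue_rel_def using glue_semidist_triangle[OF assms, of d x z y] by auto
  qed
qed

lemma (in ext_metric_space) glue_dist_eq:
  assumes r: "equiv X r" and A: "A \<in> glue_space X d r" "a \<in> A"
    and B: "B \<in> glue_space X d r" "b \<in> B"
  shows "glue_dist X d r A B = glue_semidist X d r a b"
proof -
  let ?\<delta> = "glue_semidist X d r"
  have zero: "?\<delta> u v = 0" if "C \<in> glue_space X d r" "u \<in> C" "v \<in> C" for u v C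
    using quotient_eq_iff[OF equiv_glue_rel[OF r], of C C u v] that
    unfolding glue_space_def glue_rel_def by auto
  have le: "?\<delta> u v \<le> ?\<delta> u' v'"
    if "u \<in> A" "u' \<in> A" "v \<in> B" "v' \<in> B" for u v u' v'
  proof -
    have "?\<delta> u v \<le> ?\<delta> u u' + ?\<delta> u' v" by (rule glue_semidist_triangle[OF r])
    also have "?\<delta> u' v \<le> ?\<delta> u' v' + ?\<delta> v' v" by (rule glue_semidist_triangle[OF r])
    finally show ?thesis
      using zero[OF A(1) that(1,2)] zero[OF B(1) that(4,3)] by simp
  qed
  have "(SOME a. a \<in> A) \<in> A" "(SOME b. b \<in> B) \<in> B"
    using A(2) B(2) by (auto intro: someI)
  then show ?thesis
    unfolding glue_dist_def using le A(2) B(2) by (intro antisym) blast+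
qed

lemma (in ext_metric_space) glue_dist_class:
  assumes r: "equiv X r" and x: "x \<in> X" and y: "y \<in> X"
  shows "glue_dist X d r (glue_rel X d r `` {x}) (glue_rel X d r `` {y}) = glue_semidist X d r x y"
  by (rule glue_dist_eq[OF r])
    (simp_all only: glue_space_def quotientI x y equiv_class_self[OF equiv_glue_rel[OF r]])

lemma (in ext_metric_space) ext_metric_space_glue:
  assumes r: "equiv X r"
  shows "ext_metric_space (glue_space X d r) (glue_dist X d r)"
proof -
  have rep: "\<exists>a\<in>X. A = glue_rel X d r `` {a}" if "A \<in> glue_space X d r" for A
    using that unfolding glue_space_def by (auto elim: quotientE)
  show ?thesis
  proof
    fix A B
    assume "A \<in> glue_space X d r" "B \<in> glue_space X d r"
    then obtain a b where ab: "a \<in> X" "b \<in> X"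
      and AB: "A = glue_rel X d r `` {a}" "B = glue_rel X d r `` {b}"
      using rep by meson
    have "glue_rel X d r `` {a} = glue_rel X d r `` {b} \<longleftrightarrow> (a, b) \<in> glue_rel X d r"
      using eq_equiv_class_iff[OF equiv_glue_rel[OF r] ab] .
    then show "glue_dist X d r A B = 0 \<longleftrightarrow> A = B"
      unfolding AB glue_dist_class[OF r ab] using ab by (auto simp: glue_rel_def)
    show "glue_dist X d r A B = glue_dist X d r B A"
      unfolding glue_dist_def by (rule glue_semidist_commute[OF r])
  next
    fix A B C
    show "glue_dist X d r A C \<le> glue_dist X d r A B + glue_dist X d r B C"
      unfolding glue_dist_def by (rule glue_semidist_triangle[OF r])
  qed
qed

lemma equiv_generated_equiv:
  assumes "R \<subseteq> Z \<times> Z"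
  shows "equiv Z (generated_equiv Z R)"
proof (rule equivI)
  have full: "Z \<times> Z \<in> {E. equiv Z E \<and> R \<subseteq> E}"
    using assms by (auto simp: equiv_def refl_on_def sym_def trans_def)
  show "generated_equiv Z R \<subseteq> Z \<times> Z"
    unfolding generated_equiv_def using full by (rule Inter_lower)
  show "refl_on Z (generated_equiv Z R)"
    unfolding generated_equiv_def equiv_def refl_on_def by simp
  show "sym (generated_equiv Z R)"
    unfolding generated_equiv_def equiv_def sym_def by simp
  show "trans (generated_equiv Z R)"
  proof (rule transI, unfold generated_equiv_def, rule InterI)
    fix x y z E
    assume "(x, y) \<in> \<Inter>{E. equiv Z E \<and> R \<subseteq> E}" "(y, z) \<in> \<Inter>{E. equiv Z E \<and> R \<subseteq> E}"
      and E: "E \<in> {E. equiv Z E \<and> R \<subseteq> E}"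
    then have "(x, y) \<in> E" "(y, z) \<in> E" by (meson InterD)+
    moreover have "trans E" using E by (simp add: equiv_def)
    ultimately show "(x, z) \<in> E" by (meson transD)
  qed
qed

lemma (in ext_metric_space) ext_metric_space_pieces:
  "ext_metric_space (pieces_space X d S) (pieces_dist d)"
proof
  fix u v
  assume uv: "u \<in> pieces_space X d S" "v \<in> pieces_space X d S"
  show "pieces_dist d u v = 0 \<longleftrightarrow> u = v"
    using uv by (cases u; cases v) (auto simp: pieces_space_def zero_iff ennreal_eq_0_iff)
  show "pieces_dist d u v = pieces_dist d v u"
    using uv by (cases u; cases v) (auto simp: pieces_space_def abs_minus_commute intro: commute)
next
  fix u v w
  assume "u \<in> pieces_space X d S" "v \<in> pieces_space X d S" "w \<in> pieces_space X d S"
  then show "pieces_dist d u w \<le> pieces_dist d u v + pieces_dist d v w"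
    by (cases u; cases v; cases w)
      (auto simp: pieces_space_def simp flip: ennreal_plus intro: triangle ennreal_leI)
qed

lemma endpoint_identifications_subset:
  assumes "S \<subseteq> X \<times> X"
  shows "endpoint_identifications d S \<subseteq> pieces_space X d S \<times> pieces_space X d S"
  using assms by (auto simp: endpoint_identifications_def pieces_space_def)

lemma (in ext_metric_space) ext_metric_space_convex_completion:
  assumes "S \<subseteq> X \<times> X"
  shows "ext_metric_space (convex_completion X d S) (convex_completion_dist X d S)"
  unfolding convex_completion_def convex_completion_dist_def endpoint_rel_def
  by (intro ext_metric_space.ext_metric_space_glue ext_metric_space_pieces
      equiv_generated_equiv endpoint_identifications_subset assms)

end

theory Submission
  imports Defs
begin

text \<open>
  Every upper bound on the glued semi-metric \<open>\<delta>\<close> used below comes from the triangle inequality,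
  and every lower bound from one principle (\<open>glue_semidist_ge_short_function\<close>): a function on the
  pieces which is 1-Lipschitz and takes equal values at glued points is 1-Lipschitz for \<open>\<delta>\<close>.
  Two test functions suffice. The first shows that \<open>X\<close> embeds isometrically in its completion
  (\<open>semidist_Base\<close>); a new segment is no shortcut, because its length is the distance of its
  endpoints. The second shows that inside a new segment \<open>\<delta>\<close> is the usual distance
  (\<open>semidist_same_segment\<close>), and that a geodesic from an inner point of a segment to a point
  outside of it leaves through one of the two endpoints (\<open>semidist_leave_segment\<close>).

  Convexity: a point that is strictly between two points of \<open>X\<close> lies on a segment joining them,
  old or new; if one of the points is inside a new segment, then a point strictly between them is
  found on the way to the endpoint through which the geodesic leaves, or at the midpoint if both
  are on the same segment (\<open>splittable_exit\<close>, \<open>splittable_all\<close>).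

  Completeness: let a Cauchy sequence be given. If the distances of its members from \<open>X\<close> tend to
  zero, then the nearest points in \<open>X\<close> form a Cauchy sequence in \<open>X\<close>, with the same limit.
  Otherwise some late member has distance at least \<open>\<epsilon>\<close> from \<open>X\<close> while all later members are within
  \<open>\<epsilon>\<close> of it; they can then not have left its segment, and the sequence converges in this compact
  interval.
\<close>

section \<open>Short functions, convexity and completeness of glued spaces\<close>

text \<open>
  Along a chain, the jumps between glued points do not change \<open>f\<close>, and each step in \<open>Z\<close> raises it by
  at most the length of the step.
\<close>

lemma glue_semidist_ge_short_function:
  fixes f :: "'a \<Rightarrow> ennreal"
  assumes short: "\<And>u v. u \<in> Z \<Longrightarrow> v \<in> Z \<Longrightarrow> f v \<le> f u + d u v"
    and glued: "\<And>u v. (u, v) \<in> r \<Longrightarrow> f u = f v"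
  shows "f z' \<le> f z + glue_semidist Z d r z z'"
proof (cases "f z = \<infinity>")
  case False
  have "f z' - f z \<le> glue_semidist Z d r z z'"
  proof (rule glue_semidist_greatest)
    fix n p q
    assume c: "glue_chain Z r z z' n p q"
    have "f (q k) \<le> f z + (\<Sum>s\<le>k. d (p s) (q s))" if "k \<le> n" for k
      using that
    proof (induction k)
      case 0
      then show ?case using c short[of "p 0" "q 0"] by (auto simp: glue_chain_def)
    next
      case (Suc k)
      have "f (q (Suc k)) \<le> f (p (Suc k)) + d (p (Suc k)) (q (Suc k))"
        using c Suc.prems by (intro short) (auto simp: glue_chain_def)
      also have "f (p (Suc k)) = f (q k)"
        using c Suc.prems by (intro glued[symmetric]) (auto simp: glue_chain_def)
      also have "f (q k) \<le> f z + (\<Sum>s\<le>k. d (p s) (q s))"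
        using Suc by simp
      finally show ?case by (simp add: add.assoc)
    qed
    from this[of n] have "f z' \<le> f z + (\<Sum>s\<le>n. d (p s) (q s))"
      using c by (simp add: glue_chain_def)
    then show "f z' - f z \<le> (\<Sum>s\<le>n. d (p s) (q s))"
      using False by (simp add: ennreal_minus_le_iff)
  qed
  then show ?thesis using False by (simp add: ennreal_minus_le_iff)
qed simp

lemma generated_equiv_superset: "R \<subseteq> generated_equiv Z R"
  unfolding generated_equiv_def by blast

lemma generated_equiv_constant:
  assumes "R \<subseteq> Z \<times> Z" and "\<And>u v. (u, v) \<in> R \<Longrightarrow> f u = f v"
    and "(u, v) \<in> generated_equiv Z R"
  shows "f u = f v"
proof -
  let ?E = "{(u, v). u \<in> Z \<and> v \<in> Z \<and> f u = f v}"
  have "equiv Z ?E"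
    by (rule equivI) (auto simp: refl_on_def sym_def trans_def)
  moreover have "R \<subseteq> ?E" using assms(1,2) by auto
  ultimately have "(u, v) \<in> ?E" using assms(3) unfolding generated_equiv_def by blast
  then show ?thesis by simp
qed

lemma (in ext_metric_space) glue_semidist_glued:
  assumes "x \<in> X" "y \<in> X" "(x, y) \<in> r"
  shows "glue_semidist X d r x y = 0"
proof -
  let ?p = "\<lambda>s::nat. if s = 0 then x else y"
  have "glue_chain X r x y 1 ?p ?p" using assms by (simp add: glue_chain_def)
  from glue_semidist_le[OF this, of d] show ?thesis
    using assms zero_iff[of x x] zero_iff[of y y] by simp
qed

lemma ext_CauchyD:
  assumes "ext_Cauchy X d \<sigma>" "0 < e"
  shows "\<exists>N. \<forall>m\<ge>N. \<forall>n\<ge>N. d (\<sigma> m) (\<sigma> n) < ennreal e"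
proof -
  have "0 < ennreal e" using assms(2) by (simp add: ennreal_less_zero_iff)
  then show ?thesis using assms(1) unfolding ext_Cauchy_def by blast
qed

lemma ext_CauchyI:
  assumes "range \<sigma> \<subseteq> X"
    and "\<And>e::real. 0 < e \<Longrightarrow> \<exists>N. \<forall>m\<ge>N. \<forall>n\<ge>N. d (\<sigma> m) (\<sigma> n) < ennreal e"
  shows "ext_Cauchy X d \<sigma>"
  unfolding ext_Cauchy_def
proof (intro conjI assms(1) allI impI)
  fix \<epsilon> :: ennreal
  assume "0 < \<epsilon>"
  from dense[OF this] obtain e where e: "0 < e" "e < \<epsilon>" by blast
  have "e \<noteq> top" using e(2) by auto
  then obtain x where x: "e = ennreal x" "0 < x"
    using e(1) by (cases e) (simp_all add: ennreal_less_zero_iff)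
  show "\<exists>N. \<forall>m\<ge>N. \<forall>n\<ge>N. d (\<sigma> m) (\<sigma> n) < \<epsilon>"
    using assms(2)[OF x(2)] less_trans[OF _ e(2)[unfolded x(1)]] by blast
qed

text \<open>
  If \<open>\<delta>\<close> satisfies the triangle inequality and \<open>\<delta> x y\<close> is finite, then the two bounds on \<open>z\<close> must
  be equalities, so that \<open>z\<close> lies between \<open>x\<close> and \<open>y\<close> at positive distance from both. In this form,
  distances to \<open>z\<close> need only be estimated from above.
\<close>

definition splittable :: "'a set \<Rightarrow> ('a \<Rightarrow> 'a \<Rightarrow> ennreal) \<Rightarrow> 'a \<Rightarrow> 'a \<Rightarrow> bool" where
  "splittable Z \<delta> x y \<longleftrightarrow>
     (\<exists>z\<in>Z. \<exists>\<alpha>>0. \<exists>\<beta>>0. \<delta> x z \<le> \<alpha> \<and> \<delta> z y \<le> \<beta> \<and> \<alpha> + \<beta> \<le> \<delta> x y)"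

lemma (in ext_metric_space) convex_glue:
  assumes r: "equiv X r"
    and split: "\<And>x y. x \<in> X \<Longrightarrow> y \<in> X \<Longrightarrow> 0 < glue_semidist X d r x y
      \<Longrightarrow> glue_semidist X d r x y < \<infinity> \<Longrightarrow> splittable X (glue_semidist X d r) x y"
  shows "convex_ext_metric_space (glue_space X d r) (glue_dist X d r)"
proof -
  let ?\<delta> = "glue_semidist X d r" and ?C = "\<lambda>x. glue_rel X d r `` {x}"
  interpret G: ext_metric_space "glue_space X d r" "glue_dist X d r"
    by (rule ext_metric_space_glue[OF r])
  have C: "?C x \<in> glue_space X d r" if "x \<in> X" for x
    using that by (simp add: glue_space_def quotientI)
  have eq: "?C x = ?C y \<longleftrightarrow> ?\<delta> x y = 0" if "x \<in> X" "y \<in> X" for x y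
    using G.zero_iff[OF C C, of x y] that glue_dist_class[OF r that] by simp
  show ?thesis
  proof
    fix A B
    assume AB: "A \<in> glue_space X d r" "B \<in> glue_space X d r" "A \<noteq> B"
      and fin: "glue_dist X d r A B < \<infinity>"
    then obtain x y where xy: "x \<in> X" "y \<in> X" "A = ?C x" "B = ?C y"
      unfolding glue_space_def by (meson quotientE)
    have fin': "?\<delta> x y < \<infinity>"
      using fin unfolding xy(3,4) glue_dist_class[OF r xy(1,2)] .
    have "0 < ?\<delta> x y"
      using AB(3) eq[OF xy(1,2)] unfolding xy(3,4) zero_less_iff_neq_zero by simp
    with fin' obtain z \<alpha> \<beta> where z: "z \<in> X" "\<alpha> > 0" "\<beta> > 0" "?\<delta> x z \<le> \<alpha>" "?\<delta> z y \<le> \<beta>"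
        "\<alpha> + \<beta> \<le> ?\<delta> x y"
      using split[OF xy(1,2)] unfolding splittable_def by blast
    have tri: "?\<delta> x y \<le> ?\<delta> x z + ?\<delta> z y" by (rule glue_semidist_triangle[OF r])
    have "\<alpha> + \<beta> < \<infinity>" using z(6) fin' by (rule le_less_trans)
    then have ab: "\<alpha> \<noteq> top" "\<beta> \<noteq> top" by auto
    have sum: "?\<delta> x y = ?\<delta> x z + ?\<delta> z y"
      using tri order_trans[OF add_mono[OF z(4,5)] z(6)] by (rule antisym)
    have "\<alpha> + 0 < \<alpha> + \<beta>" "\<beta> + 0 < \<beta> + \<alpha>"
      unfolding ennreal_add_left_cancel_less using ab z(2,3) by simp_all
    then have less: "?\<delta> x z < ?\<delta> x y" "?\<delta> z y < ?\<delta> x y"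
      using le_less_trans[OF z(4)] le_less_trans[OF z(5)] less_le_trans[OF _ z(6)]
      by (simp_all add: add.commute)
    have "?\<delta> x z \<noteq> 0"
    proof
      assume "?\<delta> x z = 0"
      then show False using sum less(2) by simp
    qed
    moreover have "?\<delta> z y \<noteq> 0"
    proof
      assume "?\<delta> z y = 0"
      then show False using sum less(1) by simp
    qed
    ultimately have "?C z \<noteq> A" "?C z \<noteq> B"
      using eq[OF xy(1) z(1)] eq[OF z(1) xy(2)] unfolding xy(3,4) by metis+
    moreover have "glue_dist X d r A B = glue_dist X d r A (?C z) + glue_dist X d r (?C z) B"
      using sum unfolding xy(3,4) by (simp add: glue_dist_class[OF r] xy(1,2) z(1))
    ultimately show "\<exists>Z\<in>glue_space X d r. Z \<noteq> A \<and> Z \<noteq> B \<and>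
        glue_dist X d r A B = glue_dist X d r A Z + glue_dist X d r Z B"
      using C[OF z(1)] by (intro bexI[of _ "?C z"] conjI)
  qed
qed

lemma (in ext_metric_space) complete_glue:
  assumes r: "equiv X r"
    and lim: "\<And>\<sigma>. ext_Cauchy X (glue_semidist X d r) \<sigma>
      \<Longrightarrow> \<exists>x\<in>X. (\<lambda>n. glue_semidist X d r (\<sigma> n) x) \<longlonglongrightarrow> 0"
  shows "complete_ext_metric_space (glue_space X d r) (glue_dist X d r)"
proof -
  let ?\<delta> = "glue_semidist X d r" and ?C = "\<lambda>x. glue_rel X d r `` {x}"
  interpret G: ext_metric_space "glue_space X d r" "glue_dist X d r"
    by (rule ext_metric_space_glue[OF r])
  show ?thesis
  proof
    fix \<sigma>
    assume \<sigma>: "ext_Cauchy (glue_space X d r) (glue_dist X d r) \<sigma>"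
    have "\<exists>x\<in>X. \<sigma> n = ?C x" for n
    proof -
      have "\<sigma> n \<in> X // glue_rel X d r"
        using \<sigma> unfolding ext_Cauchy_def glue_space_def by blast
      then show ?thesis by (rule quotientE) blast
    qed
    then obtain \<rho> where \<rho>: "\<And>n. \<rho> n \<in> X" "\<And>n. \<sigma> n = ?C (\<rho> n)" by metis
    have "ext_Cauchy X ?\<delta> \<rho>"
      using \<sigma> \<rho>(1) unfolding ext_Cauchy_def \<rho>(2) glue_dist_class[OF r \<rho>(1) \<rho>(1)] by auto
    then obtain x where x: "x \<in> X" "(\<lambda>n. ?\<delta> (\<rho> n) x) \<longlonglongrightarrow> 0" using lim by blast
    then have "(\<lambda>n. glue_dist X d r (\<sigma> n) (?C x)) \<longlonglongrightarrow> 0"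
      unfolding \<rho>(2) glue_dist_class[OF r \<rho>(1) x(1)] by blast
    moreover have "?C x \<in> glue_space X d r" using x(1) by (simp add: glue_space_def quotientI)
    ultimately show "\<exists>A\<in>glue_space X d r. (\<lambda>n. glue_dist X d r (\<sigma> n) A) \<longlonglongrightarrow> 0" by blast
  qed
qed

section \<open>Distances in the convex completion\<close>

locale attached_segments = ext_metric_space +
  fixes S :: "('a \<times> 'a) set"
  assumes S_subset: "S \<subseteq> X \<times> X"
    and S_finite: "(x, x') \<in> S \<Longrightarrow> d x x' < \<infinity>"
begin

abbreviation "len x x' \<equiv> enn2real (d x x')"
abbreviation "Z \<equiv> pieces_space X d S"
abbreviation "r \<equiv> endpoint_rel X d S"
abbreviation "\<delta> \<equiv> glue_semidist Z (pieces_dist d) r"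

sublocale P: ext_metric_space Z "pieces_dist d"
  by (rule ext_metric_space_pieces)

lemma ennreal_len: "(x, x') \<in> S \<Longrightarrow> ennreal (len x x') = d x x'"
  using S_finite[of x x'] by simp

lemma S_mem: "(x, x') \<in> S \<Longrightarrow> x \<in> X" "(x, x') \<in> S \<Longrightarrow> x' \<in> X"
  using S_subset by auto

lemma Base_mem [simp]: "Base x \<in> Z \<longleftrightarrow> x \<in> X"
  by (auto simp: pieces_space_def)

lemma Seg_mem [simp]: "Seg x x' t \<in> Z \<longleftrightarrow> (x, x') \<in> S \<and> 0 \<le> t \<and> t \<le> len x x'"
  by (auto simp: pieces_space_def)

lemma equiv_r: "equiv Z r"
  unfolding endpoint_rel_def
  by (intro equiv_generated_equiv endpoint_identifications_subset S_subset)

lemma semidist_short_function: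
  assumes "\<And>u v. u \<in> Z \<Longrightarrow> v \<in> Z \<Longrightarrow> f v \<le> f u + pieces_dist d u v"
    and "\<And>x x'. (x, x') \<in> S \<Longrightarrow> f (Seg x x' 0) = f (Base x)"
    and "\<And>x x'. (x, x') \<in> S \<Longrightarrow> f (Seg x x' (len x x')) = f (Base x')"
  shows "f v \<le> f u + \<delta> u v"
proof (rule glue_semidist_ge_short_function)
  fix u v
  assume "(u, v) \<in> r"
  then show "f u = f v"
    unfolding endpoint_rel_def
    by (rule generated_equiv_constant[OF endpoint_identifications_subset[OF S_subset], rotated])
      (use assms(2,3) in \<open>auto simp: endpoint_identifications_def\<close>)
qed (rule assms(1))

lemma triangle: "\<delta> u w \<le> \<delta> u v + \<delta> v w"
  by (rule glue_semidist_triangle[OF equiv_r])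

lemma sym: "\<delta> u v = \<delta> v u"
  by (rule P.glue_semidist_commute[OF equiv_r])

lemma semidist_le: "u \<in> Z \<Longrightarrow> v \<in> Z \<Longrightarrow> \<delta> u v \<le> pieces_dist d u v"
  by (rule glue_semidist_le_dist)

lemma semidist_cong_left: "\<delta> u w = 0 \<Longrightarrow> \<delta> u v = \<delta> w v"
  using triangle[of u v w] triangle[of w v u] sym[of u w] by (auto intro: antisym)

lemma semidist_endpoints:
  assumes "(x, x') \<in> S"
  shows "\<delta> (Seg x x' 0) (Base x) = 0" and "\<delta> (Seg x x' (len x x')) (Base x') = 0"
proof -
  have "(Seg x x' 0, Base x) \<in> r" "(Seg x x' (len x x'), Base x') \<in> r"
    unfolding endpoint_rel_def
    by (rule subsetD[OF generated_equiv_superset],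
        use assms in \<open>auto simp: endpoint_identifications_def\<close>)+
  then show "\<delta> (Seg x x' 0) (Base x) = 0" "\<delta> (Seg x x' (len x x')) (Base x') = 0"
    using assms S_mem[OF assms] by (auto intro!: P.glue_semidist_glued)
qed

lemma semidist_Seg_start:
  assumes "Seg x x' t \<in> Z"
  shows "\<delta> (Seg x x' t) (Base x) \<le> ennreal t"
proof -
  have "\<delta> (Seg x x' t) (Base x) \<le> \<delta> (Seg x x' t) (Seg x x' 0) + \<delta> (Seg x x' 0) (Base x)"
    by (rule triangle)
  also have "\<dots> \<le> ennreal t"
    using assms semidist_endpoints(1)[of x x'] semidist_le[of "Seg x x' t" "Seg x x' 0"] by simp
  finally show ?thesis .
qed

lemma semidist_Seg_end:
  assumes "Seg x x' t \<in> Z"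
  shows "\<delta> (Seg x x' t) (Base x') \<le> ennreal (len x x' - t)"
proof -
  let ?l = "len x x'"
  have "\<delta> (Seg x x' t) (Base x') \<le> \<delta> (Seg x x' t) (Seg x x' ?l) + \<delta> (Seg x x' ?l) (Base x')"
    by (rule triangle)
  also have "\<dots> \<le> ennreal (?l - t)"
    using assms semidist_endpoints(2)[of x x'] semidist_le[of "Seg x x' t" "Seg x x' ?l"]
    by simp
  finally show ?thesis .
qed

lemma min_le_min_add:
  fixes a b a' b' e :: ennreal
  assumes "a' \<le> a + e" "b' \<le> b + e"
  shows "min a' b' \<le> min a b + e"
  using assms by (auto simp: min_def intro: order_trans)

lemma ennreal_le_add_abs_diff:
  assumes "\<bar>s - t\<bar> \<le> e" "0 \<le> s"
  shows "ennreal t \<le> ennreal s + ennreal e"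
proof -
  have "ennreal t \<le> ennreal (s + e)" using assms by (intro ennreal_leI) linarith
  then show ?thesis using assms by simp
qed

text \<open>
  The test function is the distance from \<open>Base b\<close> in the completion, given by its expected formula.
  It agrees at glued points because \<open>d\<close> satisfies the triangle inequality and segments are as long as
  the distance of their endpoints.
\<close>

lemma semidist_Base:
  assumes b: "b \<in> X" and c: "c \<in> X"
  shows "\<delta> (Base b) (Base c) = d b c"
proof (rule antisym)
  define f where "f v = (case v of Base y \<Rightarrow> d b y
    | Seg y y' t \<Rightarrow> min (d b y + ennreal t) (d b y' + ennreal (len y y' - t)))" for v
  have "f (Base c) \<le> f (Base b) + \<delta> (Base b) (Base c)"
  proof (rule semidist_short_function)
    fix u v
    assume uv: "u \<in> Z" "v \<in> Z"
    have seg: "f (Seg y y' t) \<le> f (Seg y y' s) + ennreal \<bar>s - t\<bar>"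
      if "Seg y y' s \<in> Z" "Seg y y' t \<in> Z" for y y' s t
      unfolding f_def using that
      by (auto intro!: min_le_min_add ennreal_le_add_abs_diff add_left_mono simp: add.assoc)
    show "f v \<le> f u + pieces_dist d u v"
      using uv seg ext_metric_space_axioms[THEN ext_metric_space.triangle, of b] b
      by (cases u; cases v) (auto simp: f_def)
  next
    fix x x'
    assume S: "(x, x') \<in> S"
    have "d b x \<le> d b x' + d x x'" "d b x' \<le> d b x + d x x'"
      using S_mem[OF S] ext_metric_space_axioms[THEN ext_metric_space.triangle, of b] b
        commute[of x x'] by metis+
    then show "f (Seg x x' 0) = f (Base x)" "f (Seg x x' (len x x')) = f (Base x')"
      using S_finite[OF S] by (auto simp: f_def min_def)
  qed
  then show "d b c \<le> \<delta> (Base b) (Base c)"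
    using zero_iff[OF b b] by (simp add: f_def)
  show "\<delta> (Base b) (Base c) \<le> d b c"
    using semidist_le[of "Base b" "Base c"] b c by simp
qed

text \<open>
  The test function is again the expected distance, now from a fixed point of a segment: along the
  segment if the target is on it, and otherwise through one of the two endpoints. The two cases agree
  where the segment is glued to \<open>X\<close>, because \<open>X\<close> is embedded isometrically: the detour to one
  endpoint through the other is never shorter than the direct way.
\<close>

context
  fixes x x' :: 'a and s :: real
  assumes u: "Seg x x' s \<in> Z"
begin

definition exit_dist :: "'a with_segments \<Rightarrow> ennreal" where
  "exit_dist v = min (ennreal s + \<delta> (Base x) v) (ennreal (len x x' - s) + \<delta> (Base x') v)"

definition from_segment :: "'a with_segments \<Rightarrow> ennreal" where
  "from_segment v =
     (if \<exists>t. v = Seg x x' t then pieces_dist d (Seg x x' s) v else exit_dist v)"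

lemma from_segment_le: "from_segment v \<le> \<delta> (Seg x x' s) v"
proof -
  let ?u = "Seg x x' s"
  have S: "(x, x') \<in> S" and s: "0 \<le> s" "s \<le> len x x'" using u by auto
  have "from_segment v \<le> from_segment ?u + \<delta> ?u v"
  proof (rule semidist_short_function)
    fix v w
    assume vw: "v \<in> Z" "w \<in> Z"
    have "\<delta> (Base y) w \<le> \<delta> (Base y) v + pieces_dist d v w" for y
      using triangle[of "Base y" w v] semidist_le[OF vw]
      by (meson add_left_mono order_trans)
    then have out: "exit_dist w \<le> exit_dist v + pieces_dist d v w"
      unfolding exit_dist_def by (intro min_le_min_add) (simp_all add: add.assoc add_left_mono)
    have "pieces_dist d v w = \<infinity>" if "(\<exists>t. v = Seg x x' t) \<noteq> (\<exists>t. w = Seg x x' t)"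
      using that by (cases v; cases w) auto
    then show "from_segment w \<le> from_segment v + pieces_dist d v w"
      using out P.triangle[OF u vw] by (auto simp: from_segment_def)
  next
    fix y y'
    assume yy: "(y, y') \<in> S"
    have cong: "exit_dist v = exit_dist w" if "\<delta> v w = 0" for v w
      unfolding exit_dist_def using semidist_cong_left[OF that] sym by metis
    have ends: "exit_dist (Base x) = ennreal s" "exit_dist (Base x') = ennreal (len x x' - s)"
    proof -
      have "\<delta> (Base x) (Base x') = ennreal (len x x')" "\<delta> (Base x') (Base x) = ennreal (len x x')"
        "\<delta> (Base x) (Base x) = 0" "\<delta> (Base x') (Base x') = 0"
        using S_mem[OF S] ennreal_len[OF S] sym P.glue_semidist_self by (auto simp: semidist_Base)
      then show "exit_dist (Base x) = ennreal s"
          "exit_dist (Base x') = ennreal (len x x' - s)"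
        unfolding exit_dist_def using s
        by (auto simp flip: ennreal_plus simp: min_def intro!: antisym ennreal_leI)
    qed
    show "from_segment (Seg y y' 0) = from_segment (Base y)"
      using ends(1) cong[OF semidist_endpoints(1)[OF yy]] s by (auto simp: from_segment_def)
    show "from_segment (Seg y y' (len y y')) = from_segment (Base y')"
      using ends(2) cong[OF semidist_endpoints(2)[OF yy]] s
      by (auto simp: from_segment_def abs_minus_commute)
  qed
  then show ?thesis by (simp add: from_segment_def)
qed

lemma semidist_same_segment:
  assumes "Seg x x' t \<in> Z"
  shows "\<delta> (Seg x x' s) (Seg x x' t) = ennreal \<bar>s - t\<bar>"
  using from_segment_le[of "Seg x x' t"] semidist_le[OF u assms]
  by (simp add: from_segment_def antisym)

lemma semidist_leave_segment:
  assumes "\<nexists>t. v = Seg x x' t"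
  shows "\<delta> (Seg x x' s) v
    = min (ennreal s + \<delta> (Base x) v) (ennreal (len x x' - s) + \<delta> (Base x') v)"
proof (rule antisym)
  have "\<delta> (Seg x x' s) v \<le> ennreal s + \<delta> (Base x) v"
    using triangle[of "Seg x x' s" v "Base x"] semidist_Seg_start[OF u]
    by (meson add_right_mono order_trans)
  moreover have "\<delta> (Seg x x' s) v \<le> ennreal (len x x' - s) + \<delta> (Base x') v"
    using triangle[of "Seg x x' s" v "Base x'"] semidist_Seg_end[OF u]
    by (meson add_right_mono order_trans)
  ultimately show "\<delta> (Seg x x' s) v
      \<le> min (ennreal s + \<delta> (Base x) v) (ennreal (len x x' - s) + \<delta> (Base x') v)" by simp
qed (use from_segment_le[of v] assms in \<open>simp add: from_segment_def exit_dist_def\<close>)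

end

section \<open>Convexity\<close>

lemma splittable_sym: "splittable Z \<delta> u v \<Longrightarrow> splittable Z \<delta> v u"
  unfolding splittable_def using sym by (metis add.commute)

lemma splittable_cong_left: "\<delta> u w = 0 \<Longrightarrow> splittable Z \<delta> w v \<Longrightarrow> splittable Z \<delta> u v"
  unfolding splittable_def using semidist_cong_left by metis

lemma splittable_halves:
  assumes "w \<in> Z" "\<delta> u v = ennreal l" "0 < \<delta> u v"
    "\<delta> u w \<le> ennreal (l / 2)" "\<delta> w v \<le> ennreal (l / 2)"
  shows "splittable Z \<delta> u v"
proof -
  have l: "0 < l" using assms(2,3) by (simp add: ennreal_less_zero_iff)
  then have "0 < ennreal (l / 2)" by (simp add: ennreal_less_zero_iff)
  moreover have "ennreal (l / 2) + ennreal (l / 2) = \<delta> u v"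
    using ennreal_plus[of "l / 2" "l / 2"] l assms(2) by simp
  ultimately show ?thesis unfolding splittable_def using assms(1,4,5) by (metis order_refl)
qed

text \<open>
  Here \<open>e\<close> stands for the endpoint through which a geodesic from \<open>u\<close> to \<open>v\<close> leaves the segment of \<open>u\<close>,
  at distance \<open>\<rho>\<close> from \<open>u\<close> along the segment, and \<open>w\<close> for the point halfway to it, which splits the
  geodesic if \<open>\<rho> > 0\<close>. If \<open>\<rho> = 0\<close>, then \<open>u\<close> is glued to \<open>e\<close> and the splitting has to come from there.
\<close>

lemma splittable_exit:
  assumes "0 \<le> \<rho>" "\<delta> u v = ennreal \<rho> + \<delta> e v" "\<delta> u e \<le> ennreal \<rho>"
    and half: "w \<in> Z" "\<delta> u w \<le> ennreal (\<rho> / 2)" "\<delta> w e \<le> ennreal (\<rho> / 2)"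
    and fin: "\<delta> u v < \<infinity>" "0 < \<delta> u v"
    and base: "0 < \<delta> e v \<Longrightarrow> \<delta> e v < \<infinity> \<Longrightarrow> splittable Z \<delta> e v"
  shows "splittable Z \<delta> u v"
proof (cases "\<rho> = 0")
  case True
  then have "\<delta> u e = 0" using assms(3) by simp
  then show ?thesis
    using splittable_cong_left base fin semidist_cong_left[of u e v] by metis
next
  case False
  then have pos: "0 < ennreal (\<rho> / 2)" using assms(1) by (simp add: ennreal_less_zero_iff)
  have "\<delta> w v \<le> ennreal (\<rho> / 2) + \<delta> e v"
    using triangle[of w v e] half(3) by (meson add_right_mono order_trans)
  moreover have "ennreal (\<rho> / 2) + (ennreal (\<rho> / 2) + \<delta> e v) \<le> \<delta> u v"
    unfolding assms(2) add.assoc[symmetric] using assms(1) by (simp flip: ennreal_plus)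
  moreover have "0 < ennreal (\<rho> / 2) + \<delta> e v" using pos by (simp add: add_pos_nonneg)
  ultimately show ?thesis unfolding splittable_def using pos half(1,2) by blast
qed

lemma splittable_leave_segment:
  assumes u: "Seg x x' s \<in> Z" and v: "\<nexists>t. v = Seg x x' t"
    and fin: "\<delta> (Seg x x' s) v < \<infinity>" "0 < \<delta> (Seg x x' s) v"
    and base: "\<And>e. e \<in> {x, x'} \<Longrightarrow> 0 < \<delta> (Base e) v \<Longrightarrow> \<delta> (Base e) v < \<infinity>
      \<Longrightarrow> splittable Z \<delta> (Base e) v"
  shows "splittable Z \<delta> (Seg x x' s) v"
proof -
  let ?l = "len x x'"
  have S: "(x, x') \<in> S" and s: "0 \<le> s" "s \<le> ?l" using u by auto
  have "\<delta> (Seg x x' s) v = ennreal s + \<delta> (Base x) v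
      \<or> \<delta> (Seg x x' s) v = ennreal (?l - s) + \<delta> (Base x') v"
    unfolding semidist_leave_segment[OF u v] by (simp add: min_def)
  then show ?thesis
  proof
    assume eq: "\<delta> (Seg x x' s) v = ennreal s + \<delta> (Base x) v"
    let ?w = "Seg x x' (s / 2)"
    have w: "?w \<in> Z" using S s by auto
    show ?thesis
    proof (rule splittable_exit[OF s(1) eq semidist_Seg_start[OF u] w])
      show "\<delta> (Seg x x' s) ?w \<le> ennreal (s / 2)"
        using semidist_same_segment[OF u w] s by simp
    qed (use semidist_Seg_start[OF w] fin base in auto)
  next
    assume eq: "\<delta> (Seg x x' s) v = ennreal (?l - s) + \<delta> (Base x') v"
    let ?w = "Seg x x' ((?l + s) / 2)"
    have w: "?w \<in> Z" using S s by auto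
    have half: "?l - (?l + s) / 2 = (?l - s) / 2" "\<bar>s - (?l + s) / 2\<bar> = (?l - s) / 2"
      using s by (auto simp: field_simps)
    show ?thesis
    proof (rule splittable_exit[OF _ eq semidist_Seg_end[OF u] w])
      show "\<delta> (Seg x x' s) ?w \<le> ennreal ((?l - s) / 2)"
        using semidist_same_segment[OF u w] half by simp
      show "\<delta> ?w (Base x') \<le> ennreal ((?l - s) / 2)"
        using semidist_Seg_end[OF w] half by simp
    qed (use fin base s in auto)
  qed
qed

lemma splittable_Base:
  assumes S_contains: "\<not> segment_connected X d x y \<Longrightarrow> (x, y) \<in> S"
    and xy: "x \<in> X" "y \<in> X"
    and fin: "\<delta> (Base x) (Base y) < \<infinity>" and pos: "0 < \<delta> (Base x) (Base y)"
  shows "splittable Z \<delta> (Base x) (Base y)"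
proof (cases "segment_connected X d x y")
  case True
  then obtain a b f where f: "metric_segment X d a b f" "f a = x" "f b = y"
    unfolding segment_connected_def by blast
  let ?m = "(a + b) / 2"
  have fm: "f t \<in> X" if "t \<in> {a..b}" for t
    using f(1) that unfolding metric_segment_def by auto
  have le: "a \<le> b" using f(1) unfolding metric_segment_def by simp
  have m: "?m \<in> {a..b}" "a \<in> {a..b}" "b \<in> {a..b}" using le by auto
  have iso: "d (f s) (f t) = ennreal \<bar>s - t\<bar>" if "s \<in> {a..b}" "t \<in> {a..b}" for s t
    using f(1) that unfolding metric_segment_def by blast
  have half: "\<bar>a - ?m\<bar> = (b - a) / 2" "\<bar>?m - b\<bar> = (b - a) / 2" "\<bar>a - b\<bar> = b - a"
    using le by (auto simp: field_simps)
  show ?thesis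
  proof (rule splittable_halves[where w = "Base (f ?m)" and l = "b - a"])
    show "\<delta> (Base x) (Base y) = ennreal (b - a)"
      using iso[OF m(2,3)] half(3) f(2,3) xy by (simp add: semidist_Base)
    show "\<delta> (Base x) (Base (f ?m)) \<le> ennreal ((b - a) / 2)"
      using iso[OF m(2,1)] half(1) f(2) xy fm[OF m(1)] by (simp add: semidist_Base)
    show "\<delta> (Base (f ?m)) (Base y) \<le> ennreal ((b - a) / 2)"
      using iso[OF m(1,3)] half(2) f(3) xy fm[OF m(1)] by (simp add: semidist_Base)
  qed (use fm[OF m(1)] pos in auto)
next
  case False
  then have S: "(x, y) \<in> S" using S_contains by blast
  let ?l = "len x y" and ?w = "Seg x y (len x y / 2)"
  have w: "?w \<in> Z" using S by simp
  show ?thesis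
  proof (rule splittable_halves[OF w, where l = ?l])
    show "\<delta> (Base x) (Base y) = ennreal ?l" using ennreal_len[OF S] xy by (simp add: semidist_Base)
    show "\<delta> (Base x) ?w \<le> ennreal (?l / 2)"
      using semidist_Seg_start[OF w] sym by metis
    show "\<delta> ?w (Base y) \<le> ennreal (?l / 2)"
      using semidist_Seg_end[OF w] by simp
  qed (rule pos)
qed

lemma splittable_all:
  assumes S_contains: "\<And>x y. x \<in> X \<Longrightarrow> y \<in> X \<Longrightarrow> d x y < \<infinity> \<Longrightarrow> \<not> segment_connected X d x y
      \<Longrightarrow> (x, y) \<in> S"
    and uv: "u \<in> Z" "v \<in> Z" and fin: "0 < \<delta> u v" "\<delta> u v < \<infinity>"
  shows "splittable Z \<delta> u v"
proof -
  have base: "splittable Z \<delta> (Base x) (Base y)"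
    if "x \<in> X" "y \<in> X" "\<delta> (Base x) (Base y) < \<infinity>" "0 < \<delta> (Base x) (Base y)" for x y
    using that S_contains[of x y] by (intro splittable_Base) (auto simp: semidist_Base)
  have mixed: "splittable Z \<delta> (Base y) v"
    if y: "y \<in> X" and v: "v \<in> Z" and f: "0 < \<delta> (Base y) v" "\<delta> (Base y) v < \<infinity>" for y v
  proof (cases v)
    case (Base z)
    then show ?thesis using base[of y z] that by simp
  next
    case (Seg x x' t)
    have "splittable Z \<delta> (Seg x x' t) (Base y)"
      by (rule splittable_leave_segment)
        (use v f sym[of "Base y" v] S_mem[of x x'] Seg y base in auto)
    then show ?thesis unfolding Seg by (rule splittable_sym)
  qed
  show ?thesis
  proof (cases u)
    case (Base y)
    then show ?thesis using mixed uv fin by simp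
  next
    case u: (Seg x x' s)
    show ?thesis
    proof (cases "\<exists>t. v = Seg x x' t")
      case True
      then obtain t where v: "v = Seg x x' t" by blast
      let ?w = "Seg x x' ((s + t) / 2)"
      have w: "?w \<in> Z" using uv u v by auto
      have half: "\<bar>s - (s + t) / 2\<bar> = \<bar>s - t\<bar> / 2" "\<bar>(s + t) / 2 - t\<bar> = \<bar>s - t\<bar> / 2"
        by (auto simp: field_simps abs_if)
      show ?thesis
      proof (rule splittable_halves[OF w, where l = "\<bar>s - t\<bar>"])
        show "\<delta> u v = ennreal \<bar>s - t\<bar>" using semidist_same_segment uv u v by simp
        show "\<delta> u ?w \<le> ennreal (\<bar>s - t\<bar> / 2)"
          using semidist_same_segment[of x x' s "(s + t) / 2"] uv u w half by simp
        show "\<delta> ?w v \<le> ennreal (\<bar>s - t\<bar> / 2)"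
          using semidist_same_segment[OF w, of t] uv v half by simp
      qed (rule fin)
    next
      case False
      then show ?thesis
        unfolding u using uv fin u S_mem[of x x'] mixed[OF _ uv(2)]
        by (intro splittable_leave_segment) auto
    qed
  qed
qed

section \<open>Completeness\<close>

fun foot :: "'a with_segments \<Rightarrow> 'a" where
  "foot (Base x) = x"
| "foot (Seg x x' t) = (if t \<le> len x x' - t then x else x')"

fun height :: "'a with_segments \<Rightarrow> real" where
  "height (Base x) = 0"
| "height (Seg x x' t) = min t (len x x' - t)"

lemma foot_mem: "u \<in> Z \<Longrightarrow> foot u \<in> X"
  by (cases u) (auto dest: S_mem)

lemma height_nonneg: "u \<in> Z \<Longrightarrow> 0 \<le> height u"
  by (cases u) auto

lemma semidist_foot: "u \<in> Z \<Longrightarrow> \<delta> u (Base (foot u)) \<le> ennreal (height u)"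
  by (cases u) (auto simp: min_def P.glue_semidist_self intro: semidist_Seg_start semidist_Seg_end
      simp del: Seg_mem)

text \<open>Both ways out of a segment are at least as long as the distance to its nearer endpoint.\<close>

lemma semidist_outside_ge_height:
  assumes "Seg x x' s \<in> Z" "\<nexists>t. v = Seg x x' t"
  shows "ennreal (height (Seg x x' s)) \<le> \<delta> (Seg x x' s) v"
  unfolding semidist_leave_segment[OF assms]
  by (auto intro!: add_increasing2 ennreal_leI)

text \<open>
  The feet get arbitrarily close to the sequence, so that they form a Cauchy sequence in \<open>X\<close>, whose
  limit is also the limit of the given sequence.
\<close>

lemma converges_height_tendsto_0:
  assumes comp: "complete_ext_metric_space X d"
    and \<sigma>: "ext_Cauchy Z \<delta> \<sigma>" and lim: "(\<lambda>n. height (\<sigma> n)) \<longlonglongrightarrow> 0"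
  shows "\<exists>u\<in>Z. (\<lambda>n. \<delta> (\<sigma> n) u) \<longlonglongrightarrow> 0"
proof -
  have Z: "\<sigma> n \<in> Z" for n using \<sigma> unfolding ext_Cauchy_def by auto
  let ?b = "\<lambda>n. foot (\<sigma> n)"
  have foot: "\<delta> (\<sigma> n) (Base (?b n)) \<le> ennreal (height (\<sigma> n))" for n
    by (rule semidist_foot[OF Z])
  have "ext_Cauchy X d ?b"
  proof (rule ext_CauchyI)
    show "range ?b \<subseteq> X" using foot_mem[OF Z] by auto
    fix e :: real
    assume e: "0 < e"
    then obtain N1 where N1: "\<And>n. n \<ge> N1 \<Longrightarrow> height (\<sigma> n) < e / 3"
      using order_tendstoD(2)[OF lim, of "e / 3"] unfolding eventually_sequentially by auto
    obtain N2 where N2: "\<And>m n. m \<ge> N2 \<Longrightarrow> n \<ge> N2 \<Longrightarrow> \<delta> (\<sigma> m) (\<sigma> n) < ennreal (e / 3)"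
      using ext_CauchyD[OF \<sigma>, of "e / 3"] e by auto
    have "d (?b m) (?b n) < ennreal e" if mn: "m \<ge> max N1 N2" "n \<ge> max N1 N2" for m n
    proof -
      have near: "\<delta> (\<sigma> k) (Base (?b k)) < ennreal (e / 3)" if "k \<ge> max N1 N2" for k
        using foot[of k] N1[of k] e that
        by (meson ennreal_lessI divide_pos_pos le_less_trans max.boundedE zero_less_numeral)
      have "d (?b m) (?b n) = \<delta> (Base (?b m)) (Base (?b n))"
        using foot_mem[OF Z] by (simp add: semidist_Base)
      also have "\<dots> \<le> \<delta> (\<sigma> m) (Base (?b m)) + (\<delta> (\<sigma> m) (\<sigma> n) + \<delta> (\<sigma> n) (Base (?b n)))"
        unfolding sym[of "\<sigma> m" "Base (?b m)"]
        by (rule order_trans[OF triangle add_left_mono[OF triangle]])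
      also have "\<dots> < ennreal (e / 3 + (e / 3 + e / 3))"
        using near[OF mn(1)] near[OF mn(2)] N2[of m n] mn by (intro add_mono_ennreal) auto
      finally show ?thesis by simp
    qed
    then show "\<exists>N. \<forall>m\<ge>N. \<forall>n\<ge>N. d (?b m) (?b n) < ennreal e" by blast
  qed
  then obtain b where b: "b \<in> X" "(\<lambda>n. d (?b n) b) \<longlonglongrightarrow> 0"
    using complete_ext_metric_space.complete[OF comp] by blast
  have bound: "(\<lambda>n. ennreal (height (\<sigma> n)) + d (?b n) b) \<longlonglongrightarrow> 0"
    using tendsto_add[OF tendsto_ennrealI[OF lim] b(2)] by simp
  have le: "\<delta> (\<sigma> n) (Base b) \<le> ennreal (height (\<sigma> n)) + d (?b n) b" for n
    using order_trans[OF triangle add_right_mono[OF foot]] foot_mem[OF Z] b(1)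
    by (metis semidist_Base)
  have "(\<lambda>n. \<delta> (\<sigma> n) (Base b)) \<longlonglongrightarrow> 0"
    by (rule tendsto_sandwich[OF _ _ tendsto_const bound]) (use le in simp_all)
  then show ?thesis using b(1) by (intro bexI[of _ "Base b"]) auto
qed

text \<open>Distances on a segment are those of its parameters, which therefore converge in an interval.\<close>

lemma converges_in_segment:
  assumes \<sigma>: "ext_Cauchy Z \<delta> \<sigma>" and in_seg: "\<And>n. n \<ge> N \<Longrightarrow> \<sigma> n = Seg x x' (t n)"
  shows "\<exists>u\<in>Z. (\<lambda>n. \<delta> (\<sigma> n) u) \<longlonglongrightarrow> 0"
proof -
  have Z: "\<sigma> n \<in> Z" for n using \<sigma> unfolding ext_Cauchy_def by auto
  have tZ: "Seg x x' (t (n + N)) \<in> Z" for n using Z[of "n + N"] in_seg[of "n + N"] by simp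
  have "Cauchy (\<lambda>n. t (n + N))"
  proof (rule metric_CauchyI)
    fix e :: real
    assume e: "0 < e"
    then obtain M where M: "\<And>m n. m \<ge> M \<Longrightarrow> n \<ge> M \<Longrightarrow> \<delta> (\<sigma> m) (\<sigma> n) < ennreal e"
      using ext_CauchyD[OF \<sigma>] by blast
    have "dist (t (m + N)) (t (n + N)) < e" if "m \<ge> M" "n \<ge> M" for m n
      using M[of "m + N" "n + N"] that in_seg semidist_same_segment[OF tZ tZ, of m n] e
      by (simp add: dist_real_def ennreal_less_iff)
    then show "\<exists>M. \<forall>m\<ge>M. \<forall>n\<ge>M. dist (t (m + N)) (t (n + N)) < e" by blast
  qed
  then obtain l where l: "(\<lambda>n. t (n + N)) \<longlonglongrightarrow> l"
    using Cauchy_convergent convergent_def by blast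
  have "0 \<le> l" "l \<le> len x x'"
    using tZ by (auto intro: LIMSEQ_le_const[OF l] LIMSEQ_le_const2[OF l])
  then have lZ: "Seg x x' l \<in> Z" using tZ[of 0] by simp
  have "(\<lambda>n. \<bar>t (n + N) - l\<bar>) \<longlonglongrightarrow> 0"
    using l by (simp add: LIM_zero tendsto_rabs_zero)
  from tendsto_ennrealI[OF this] have "(\<lambda>n. ennreal \<bar>t (n + N) - l\<bar>) \<longlonglongrightarrow> 0" by simp
  then have "(\<lambda>n. \<delta> (\<sigma> (n + N)) (Seg x x' l)) \<longlonglongrightarrow> 0"
    using in_seg semidist_same_segment[OF tZ lZ] by simp
  then have "(\<lambda>n. \<delta> (\<sigma> n) (Seg x x' l)) \<longlonglongrightarrow> 0" by (rule LIMSEQ_offset)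
  then show ?thesis using lZ by blast
qed

lemma semidist_complete:
  assumes comp: "complete_ext_metric_space X d" and \<sigma>: "ext_Cauchy Z \<delta> \<sigma>"
  shows "\<exists>u\<in>Z. (\<lambda>n. \<delta> (\<sigma> n) u) \<longlonglongrightarrow> 0"
  \<comment> \<open>If the heights do not tend to zero, then some late member is too high for the sequence to
    leave its segment afterwards.\<close>
proof (cases "(\<lambda>n. height (\<sigma> n)) \<longlonglongrightarrow> 0")
  case True
  then show ?thesis by (rule converges_height_tendsto_0[OF comp \<sigma>])
next
  case False
  have Z: "\<sigma> n \<in> Z" for n using \<sigma> unfolding ext_Cauchy_def by auto
  from False obtain e where e: "0 < e" "\<And>N. \<exists>n\<ge>N. e \<le> \<bar>height (\<sigma> n)\<bar>"
    unfolding LIMSEQ_iff by (auto simp: not_less)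
  obtain N where N: "\<And>m n. m \<ge> N \<Longrightarrow> n \<ge> N \<Longrightarrow> \<delta> (\<sigma> m) (\<sigma> n) < ennreal e"
    using ext_CauchyD[OF \<sigma> e(1)] by blast
  obtain k where k: "k \<ge> N" "e \<le> height (\<sigma> k)" using e(2) height_nonneg[OF Z] by fastforce
  obtain x x' s where s: "\<sigma> k = Seg x x' s" using k(2) e(1) by (cases "\<sigma> k") auto
  have "\<exists>t. \<sigma> n = Seg x x' t" if "n \<ge> N" for n
  proof (rule ccontr)
    assume out: "\<nexists>t. \<sigma> n = Seg x x' t"
    have "ennreal e \<le> \<delta> (\<sigma> k) (\<sigma> n)"
      using semidist_outside_ge_height[OF _ out, of s] Z[of k] k(2) s
      by (metis ennreal_leI order_trans)
    then show False using N[OF k(1) that] by simp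
  qed
  then obtain t where "\<And>n. n \<ge> N \<Longrightarrow> \<sigma> n = Seg x x' (t n)" by metis
  then show ?thesis by (rule converges_in_segment[OF \<sigma>])
qed

end

theorem proposition2p35:
  fixes X :: "'a set" and d :: "'a \<Rightarrow> 'a \<Rightarrow> ennreal" and S :: "('a \<times> 'a) set"
  assumes "complete_ext_metric_space X d"
    and "S \<subseteq> X \<times> X"
    and "\<And>x x'. (x, x') \<in> S \<Longrightarrow> d x x' < \<infinity>"
    and "\<And>x x'. x \<in> X \<Longrightarrow> x' \<in> X \<Longrightarrow> d x x' < \<infinity> \<Longrightarrow> \<not> segment_connected X d x x'
           \<Longrightarrow> (x, x') \<in> S"
  shows "complete_ext_metric_space (convex_completion X d S) (convex_completion_dist X d S) \<and>
         convex_ext_metric_space (convex_completion X d S) (convex_completion_dist X d S)"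
proof -
  interpret complete_ext_metric_space X d by (rule assms(1))
  interpret attached_segments X d S
    by unfold_locales (use assms(2,3) in auto)
  show ?thesis
    unfolding convex_completion_def convex_completion_dist_def
  proof
    show "complete_ext_metric_space (glue_space Z (pieces_dist d) r) (glue_dist Z (pieces_dist d) r)"
      by (intro P.complete_glue equiv_r semidist_complete assms(1))
    show "convex_ext_metric_space (glue_space Z (pieces_dist d) r) (glue_dist Z (pieces_dist d) r)"
      by (intro P.convex_glue equiv_r splittable_all assms(4))
  qed
qed

end
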